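(* Let $\gamma(t)=e^{-t}p+(1-e^{-t})y$ be the forward geodesic of the Funk disc $(\mathbb{D},F_F)$ starting at $p\in\mathbb{D}$ with forward hitting point $y\in\partial\mathbb{D}$. Then the forward horocycles along $\gamma$ are line segments in $\mathbb{D}$ perpendicular (in the Euclidean sense) to the line joining the origin and the forward hitting point $y$.
   Context: $\mathbb{D}=\{x\in\mathbb{R}^2:|x|<1\}$, with $|\cdot|$ and $\langle\cdot,\cdot\rangle$ the Euclidean norm and inner product. The Funk metric is $F_F(x,v)=\dfrac{\sqrt{(1-|x|^2)|v|^2+\langle x,v\rangle^2}}{1-|x|^2}+\dfrac{\langle x,v\rangle}{1-|x|^2}$. Its (asymmetric) distance is $d_F(x_1,x_2)=\ln\dfrac{|x_1-a|}{|x_2-a|}$ for $x_1\neq x_2$, where $a$ is the point at which the ray from $x_1$ through $x_2$ meets $\partial\mathbb{D}$ (and $d_F(x,x)=0$). The forward Busemann function of $\gamma$ is $b_\gamma(x)=\lim_{t\to\infty}\{t-d_F(x,\gamma(t))\}$. The forward horocycles along $\gamma$ are the (nonempty) level sets $b_\gamma^{-1}(a)=\{x\in\mathbb{D}:b_\gamma(x)=a\}$, $a\in\mathbb{R}$ (limits as $t\to\infty$ of the backward spheres $\{x:d_F(x,\gamma(t))=t-a\}$). *)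

theory Defs
  imports "HOL-Analysis.Analysis"
begin

abbreviation disc :: "(real^2) set" where
  "disc \<equiv> ball 0 1"

definition funk_metric :: "real^2 \<Rightarrow> real^2 \<Rightarrow> real" where
  "funk_metric x v =
     sqrt ((1 - (norm x)\<^sup>2) * (norm v)\<^sup>2 + (x \<bullet> v)\<^sup>2) / (1 - (norm x)\<^sup>2)
     + (x \<bullet> v) / (1 - (norm x)\<^sup>2)"

text \<open>For distinct points \<open>x1\<close>, \<open>x2\<close> of the disc exactly one point satisfies the
  description below; see \<open>funk_hit_ex1\<close>.\<close>

definition funk_hit :: "real^2 \<Rightarrow> real^2 \<Rightarrow> real^2" where
  "funk_hit x1 x2 = (THE a. a \<in> frontier disc \<and> (\<exists>s\<ge>0. a = x1 + s *\<^sub>R (x2 - x1)))"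

definition funk_dist :: "real^2 \<Rightarrow> real^2 \<Rightarrow> real" where
  "funk_dist x1 x2 =
     (if x1 = x2 then 0
      else ln (norm (x1 - funk_hit x1 x2) / norm (x2 - funk_hit x1 x2)))"

definition funk_geodesic :: "real^2 \<Rightarrow> real^2 \<Rightarrow> real \<Rightarrow> real^2" where
  "funk_geodesic p y t = exp (- t) *\<^sub>R p + (1 - exp (- t)) *\<^sub>R y"

definition forward_busemann :: "(real \<Rightarrow> real^2) \<Rightarrow> real^2 \<Rightarrow> real" where
  "forward_busemann \<gamma> x = Lim at_top (\<lambda>t. t - funk_dist x (\<gamma> t))"

definition forward_horocycles :: "(real \<Rightarrow> real^2) \<Rightarrow> (real^2) set set" where
  "forward_horocycles \<gamma> =
     {H. H \<noteq> {} \<and> (\<exists>a. H = {x \<in> disc. forward_busemann \<gamma> x = a})}"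

lemma funk_hit_ex1:
  assumes "x1 \<in> disc" and "x1 \<noteq> x2"
  shows "\<exists>!a. a \<in> frontier disc \<and> (\<exists>s\<ge>0. a = x1 + s *\<^sub>R (x2 - x1))"
proof -
  have fr: "frontier disc = sphere (0::real^2) 1"
    by (simp add: frontier_ball)
  have n1: "norm x1 < 1" using assms by simp
  obtain d where d: "0 < d" "x1 + d *\<^sub>R (x2 - x1) \<in> frontier disc"
    using ray_to_frontier[of disc x1 "x2 - x1"] assms by (auto simp: interior_open)
  have *: False
    if "0 \<le> s" "s < t" "norm (x1 + s *\<^sub>R (x2 - x1)) = 1" "norm (x1 + t *\<^sub>R (x2 - x1)) = 1" for s t
  proof -
    have s0: "s \<noteq> 0" using that n1 by auto
    have e: "x1 + s *\<^sub>R (x2 - x1) = (1 - s/t) *\<^sub>R x1 + (s/t) *\<^sub>R (x1 + t *\<^sub>R (x2 - x1))"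
      using that by (simp add: algebra_simps)
    have "1 \<le> norm ((1 - s/t) *\<^sub>R x1) + norm ((s/t) *\<^sub>R (x1 + t *\<^sub>R (x2 - x1)))"
      using that(3) norm_triangle_ineq unfolding e by metis
    also have "\<dots> = (1 - s/t) * norm x1 + s/t"
      using that by simp
    also have "\<dots> < (1 - s/t) * 1 + s/t"
      using that n1 by (intro add_strict_right_mono mult_strict_left_mono) auto
    finally show False by simp
  qed
  show ?thesis
  proof (rule ex1I[of _ "x1 + d *\<^sub>R (x2 - x1)"])
    show "x1 + d *\<^sub>R (x2 - x1) \<in> frontier disc \<and>
        (\<exists>s\<ge>0. x1 + d *\<^sub>R (x2 - x1) = x1 + s *\<^sub>R (x2 - x1))"
      using d by (auto intro: exI[of _ d])
  next
    fix a assume "a \<in> frontier disc \<and> (\<exists>s\<ge>0. a = x1 + s *\<^sub>R (x2 - x1))"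
    then obtain s where s: "0 \<le> s" "a = x1 + s *\<^sub>R (x2 - x1)" "norm a = 1"
      by (auto simp: fr)
    have "s = d" using *[of s d] *[of d s] s d unfolding fr
      by (metis less_eq_real_def linorder_neqE_linordered_idom mem_sphere_0)
    then show "a = x1 + d *\<^sub>R (x2 - x1)" using s by simp
  qed
qed

text \<open>The curve runs from \<open>p\<close> towards \<open>y\<close> along a straight segment with unit Funk speed.\<close>

lemma funk_geodesic_has_vector_derivative:
  "(funk_geodesic p y has_vector_derivative (y - funk_geodesic p y t)) (at t)"
  unfolding funk_geodesic_def [abs_def]
  by (auto intro!: derivative_eq_intros simp: algebra_simps)

lemma funk_metric_geodesic:
  assumes "p \<in> disc" "y \<in> frontier disc" "0 \<le> t"
  shows "funk_geodesic p y t \<in> disc"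
    and "funk_metric (funk_geodesic p y t) (y - funk_geodesic p y t) = 1"
proof -
  have y: "norm y = 1" and p: "norm p < 1"
    using assms by (auto simp: frontier_ball)
  define x where "x = funk_geodesic p y t"
  have "norm x \<le> exp (- t) * norm p + (1 - exp (- t)) * norm y"
    unfolding x_def funk_geodesic_def using assms
    by (intro order_trans[OF norm_triangle_ineq]) simp
  also have "\<dots> < exp (- t) * 1 + (1 - exp (- t)) * norm y"
    using p by (intro add_strict_right_mono mult_strict_left_mono) auto
  finally have x: "norm x < 1" using y by simp
  then show "funk_geodesic p y t \<in> disc" by (simp add: x_def)
  have xx: "(norm x)\<^sup>2 < 1" using x by (simp add: abs_square_less_1)
  have yy: "y \<bullet> y = 1" using y by (simp add: dot_square_norm)
  have "x \<bullet> y \<le> norm x * norm y" by (rule norm_cauchy_schwarz)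
  then have xy: "x \<bullet> y < 1" using x y by simp
  have "(1 - (norm x)\<^sup>2) * (norm (y - x))\<^sup>2 + (x \<bullet> (y - x))\<^sup>2 = (1 - x \<bullet> y)\<^sup>2"
    unfolding power2_norm_eq_inner
    by (simp add: inner_diff yy inner_commute[of y x] power2_eq_square algebra_simps)
  then have "funk_metric x (y - x) = (1 - x \<bullet> y + x \<bullet> (y - x)) / (1 - (norm x)\<^sup>2)"
    using xy by (simp add: funk_metric_def add_divide_distrib)
  also have "\<dots> = 1"
    using xx by (simp add: inner_diff power2_norm_eq_inner)
  finally show "funk_metric (funk_geodesic p y t) (y - funk_geodesic p y t) = 1"
    by (simp add: x_def)
qed

end

theory Submission
  imports Defs
begin

text \<open>If \<open>a\<close> is the hitting point of the ray from \<open>x\<close> in direction \<open>v\<close>, then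
  \<open>a = x + v /\<^sub>R funk_metric x v\<close>, so that
  \<open>funk_dist x z = - ln (1 - funk_metric x (z - x))\<close>. Along the geodesic \<open>\<gamma>\<close>, with
  \<open>\<epsilon> = exp (- t)\<close>, this turns \<open>t - funk_dist x (\<gamma> t)\<close> into
  \<open>ln ((1 - funk_metric x (y - x + \<epsilon> *\<^sub>R (p - y))) / \<epsilon>)\<close>; since \<open>funk_metric x (y - x) = 1\<close>, the limit
  is governed by the derivative of the metric at \<open>y - x\<close>, and the Busemann function is
  \<open>ln ((1 - p \<bullet> y) / (1 - x \<bullet> y))\<close>. Its level sets are those of \<open>x \<bullet> y\<close>, that is, chords
  perpendicular to \<open>y\<close>.\<close>

section \<open>The Funk metric, hitting points and the distance\<close>

text \<open>With \<open>F = funk_metric x v\<close>, this is the expanded form of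
  \<open>(norm (F *\<^sub>R x + v))\<^sup>2 = F\<^sup>2\<close>: for nonzero \<open>F\<close> it
  puts \<open>x + v /\<^sub>R F\<close> on the unit circle.\<close>

lemma funk_metric_quadratic:
  assumes "norm x < 1"
  shows "(1 - (norm x)\<^sup>2) * (funk_metric x v)\<^sup>2 = 2 * (x \<bullet> v) * funk_metric x v + (norm v)\<^sup>2"
proof -
  define A where "A = 1 - (norm x)\<^sup>2"
  define S where "S = sqrt (A * (norm v)\<^sup>2 + (x \<bullet> v)\<^sup>2)"
  have A: "A > 0"
    using assms by (simp add: A_def abs_square_less_1)
  have S: "S\<^sup>2 = A * (norm v)\<^sup>2 + (x \<bullet> v)\<^sup>2"
    using A by (simp add: S_def)
  have AF: "A * funk_metric x v = S + x \<bullet> v"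
    using A by (simp add: funk_metric_def distrib_left flip: A_def S_def)
  \<comment> \<open>An extra factor \<open>A\<close> clears all denominators through
    \<open>AF\<close>; it is cancelled at the end because \<open>A > 0\<close>.\<close>
  have "A * (A * (funk_metric x v)\<^sup>2) = (S + x \<bullet> v)\<^sup>2"
    by (simp flip: AF add: power2_eq_square)
  also have "\<dots> = 2 * (x \<bullet> v) * (S + x \<bullet> v) + A * (norm v)\<^sup>2"
    using S by (simp add: power2_eq_square algebra_simps)
  also have "\<dots> = A * (2 * (x \<bullet> v) * funk_metric x v + (norm v)\<^sup>2)"
    by (simp flip: AF add: algebra_simps)
  finally show ?thesis
    using A by (simp add: A_def)
qed

lemma funk_metric_pos:
  assumes "norm x < 1" "v \<noteq> 0"
  shows "0 < funk_metric x v"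
proof -
  have A: "1 - (norm x)\<^sup>2 > 0"
    using assms by (simp add: abs_square_less_1)
  have "\<bar>x \<bullet> v\<bar> < sqrt ((1 - (norm x)\<^sup>2) * (norm v)\<^sup>2 + (x \<bullet> v)\<^sup>2)"
    using A assms(2) by (intro real_less_rsqrt) simp
  then show ?thesis
    using A by (simp add: funk_metric_def flip: add_divide_distrib)
qed

text \<open>A point \<open>z\<close> inside the disc is reached before the ray leaves it. This bound
  makes the logarithm in the distance formula well defined.\<close>

lemma funk_metric_less_1:
  assumes "norm x < 1" "norm z < 1"
  shows "funk_metric x (z - x) < 1"
proof -
  have A: "1 - (norm x)\<^sup>2 > 0"
    using assms by (simp add: abs_square_less_1)
  have z: "z \<bullet> z < 1"
    using assms by (simp add: abs_square_less_1 flip: power2_norm_eq_inner)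
  have "x \<bullet> z \<le> norm x * norm z"
    by (rule norm_cauchy_schwarz)
  also have "\<dots> < 1"
    using assms mult_strict_mono'[of "norm x" 1 "norm z" 1] by simp
  finally have xz: "x \<bullet> z < 1" .
  \<comment> \<open>The radicand falls short of a perfect square by a product that is positive
    inside the disc and would vanish for \<open>z\<close> on the circle.\<close>
  have "(1 - x \<bullet> z)\<^sup>2 - ((1 - (norm x)\<^sup>2) * (norm (z - x))\<^sup>2 + (x \<bullet> (z - x))\<^sup>2)
      = (1 - (norm x)\<^sup>2) * (1 - z \<bullet> z)"
    unfolding power2_norm_eq_inner
    by (simp add: inner_diff inner_commute[of z x] power2_eq_square algebra_simps)
  also have "\<dots> > 0"
    using A z by simp
  finally have "sqrt ((1 - (norm x)\<^sup>2) * (norm (z - x))\<^sup>2 + (x \<bullet> (z - x))\<^sup>2) < 1 - x \<bullet> z"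
    using xz by (intro real_less_lsqrt) auto
  then have "sqrt ((1 - (norm x)\<^sup>2) * (norm (z - x))\<^sup>2 + (x \<bullet> (z - x))\<^sup>2) + x \<bullet> (z - x)
      < 1 - (norm x)\<^sup>2"
    by (simp add: inner_diff power2_norm_eq_inner)
  then show ?thesis
    using A by (simp add: funk_metric_def flip: add_divide_distrib)
qed

text \<open>The quadratic equation gives the proposed point norm 1, positivity of the metric puts it
  on the ray, and \<open>funk_hit_ex1\<close> makes it the only candidate.\<close>

lemma funk_hit_eq:
  assumes "norm x < 1" "x \<noteq> z"
  shows "funk_hit x z = x + (1 / funk_metric x (z - x)) *\<^sub>R (z - x)"
proof -
  define r where "r = funk_metric x (z - x)"
  have r: "r > 0"
    using funk_metric_pos assms by (simp add: r_def)
  have q: "(1 - (norm x)\<^sup>2) * r\<^sup>2 = 2 * (x \<bullet> (z - x)) * r + (norm (z - x))\<^sup>2"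
    unfolding r_def by (rule funk_metric_quadratic[OF assms(1)])
  have "(norm (x + (1 / r) *\<^sub>R (z - x)))\<^sup>2
      = (norm x)\<^sup>2 + 2 * (x \<bullet> (z - x)) / r + (norm (z - x))\<^sup>2 / r\<^sup>2"
    by (simp only: power2_norm_eq_inner inner_add inner_scaleR_left inner_scaleR_right
        inner_commute[of "z - x" x])
       (simp add: power2_eq_square add_divide_distrib)
  also have "(norm (z - x))\<^sup>2 / r\<^sup>2 = 1 - (norm x)\<^sup>2 - 2 * (x \<bullet> (z - x)) / r"
  proof -
    have "(norm (z - x))\<^sup>2 = (1 - (norm x)\<^sup>2) * r\<^sup>2 - 2 * (x \<bullet> (z - x)) * r"
      using q by simp
    then show ?thesis
      using r by (simp add: diff_divide_distrib power2_eq_square)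
  qed
  also have "(norm x)\<^sup>2 + 2 * (x \<bullet> (z - x)) / r + (1 - (norm x)\<^sup>2 - 2 * (x \<bullet> (z - x)) / r) = 1"
    by simp
  finally have "norm (x + (1 / r) *\<^sub>R (z - x)) = 1"
    by (simp add: power2_eq_1_iff) (smt (verit) norm_ge_zero)
  then have "x + (1 / r) *\<^sub>R (z - x) \<in> frontier disc
      \<and> (\<exists>s\<ge>0. x + (1 / r) *\<^sub>R (z - x) = x + s *\<^sub>R (z - x))"
    using r by (auto simp: frontier_ball intro!: exI[of _ "1 / r"])
  then show ?thesis
    using funk_hit_ex1[of x z] assms unfolding funk_hit_def r_def
    by (intro the1_equality) auto
qed

text \<open>The vectors from \<open>x\<close> and from \<open>z\<close> to the hitting point are
  \<open>1 / r\<close> and \<open>1 / r - 1\<close> times \<open>z - x\<close>, so their lengths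
  have ratio \<open>1 / (1 - r)\<close>.\<close>

lemma funk_dist_eq:
  assumes "norm x < 1" "norm z < 1"
  shows "funk_dist x z = - ln (1 - funk_metric x (z - x))"
proof (cases "x = z")
  case True
  then show ?thesis by (simp add: funk_dist_def funk_metric_def)
next
  case False
  define r where "r = funk_metric x (z - x)"
  have r: "0 < r" "r < 1"
    using funk_metric_pos funk_metric_less_1 assms False by (auto simp: r_def)
  have h: "funk_hit x z = x + (1 / r) *\<^sub>R (z - x)"
    unfolding r_def by (rule funk_hit_eq[OF assms(1) False])
  have "x - funk_hit x z = (- (1 / r)) *\<^sub>R (z - x)"
    by (simp add: h algebra_simps)
  then have n1: "norm (x - funk_hit x z) = (1 / r) * norm (z - x)"
    using r by (simp add: norm_minus_commute)
  have "z - funk_hit x z = (1 - 1 / r) *\<^sub>R (z - x)"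
    by (simp add: h algebra_simps)
  then have "norm (z - funk_hit x z) = \<bar>1 - 1 / r\<bar> * norm (z - x)"
    by simp
  moreover have "1 / r > 1"
    using r by simp
  ultimately have n2: "norm (z - funk_hit x z) = (1 / r - 1) * norm (z - x)"
    by simp
  have "norm (x - funk_hit x z) / norm (z - funk_hit x z) = inverse (1 - r)"
    unfolding n1 n2 using r False by (simp add: field_simps)
  then show ?thesis
    using r False by (simp add: funk_dist_def ln_inverse flip: r_def)
qed

text \<open>The base point \<open>y - x\<close> points at the boundary, where the radicand of the metric is the
  square of \<open>1 - x \<bullet> y\<close>.\<close>

lemma funk_metric_boundary:
  assumes "norm x < 1" "norm y = 1"
  shows "funk_metric x (y - x) = 1"
    and "((\<lambda>e. funk_metric x (y - x + e *\<^sub>R w)) has_real_derivative (w \<bullet> y) / (1 - x \<bullet> y)) (at 0)"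
proof -
  have A: "1 - x \<bullet> x > 0"
    using assms by (simp add: abs_square_less_1 flip: power2_norm_eq_inner)
  have yy: "y \<bullet> y = 1"
    using assms by (simp add: dot_square_norm)
  have "x \<bullet> y \<le> norm x * norm y"
    by (rule norm_cauchy_schwarz)
  then have xy: "1 - x \<bullet> y > 0"
    using assms by simp
  have rad: "(1 - x \<bullet> x) * ((y - x) \<bullet> (y - x)) + (x \<bullet> (y - x))\<^sup>2 = (1 - x \<bullet> y)\<^sup>2"
    by (simp add: inner_diff yy inner_commute[of y x] power2_eq_square algebra_simps)
  have "1 - x \<bullet> y + x \<bullet> (y - x) = 1 - x \<bullet> x"
    by (simp add: inner_diff)
  then show "funk_metric x (y - x) = 1"
    using A xy by (simp add: funk_metric_def power2_norm_eq_inner rad flip: add_divide_distrib)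
  \<comment> \<open>\<open>D\<close> is the linear coefficient of the radicand as a quadratic
    polynomial in \<open>e\<close>, hence its derivative at 0.\<close>
  define D where "D = (1 - x \<bullet> x) * (2 * ((y - x) \<bullet> w)) + 2 * (x \<bullet> (y - x)) * (x \<bullet> w)"
  have rad_eq: "(1 - x \<bullet> x) * ((y - x + e *\<^sub>R w) \<bullet> (y - x + e *\<^sub>R w)) + (x \<bullet> (y - x + e *\<^sub>R w))\<^sup>2
      = (1 - x \<bullet> y)\<^sup>2 + D * e + ((1 - x \<bullet> x) * (w \<bullet> w) + (x \<bullet> w)\<^sup>2) * e\<^sup>2" for e
    unfolding rad[symmetric] D_def
    by (simp only: inner_add inner_scaleR_left inner_scaleR_right inner_commute[of w "y - x"])
       (simp add: power2_eq_square algebra_simps)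
  define q where
    "q e = (1 - x \<bullet> y)\<^sup>2 + D * e + ((1 - x \<bullet> x) * (w \<bullet> w) + (x \<bullet> w)\<^sup>2) * e\<^sup>2" for e
  have q0: "q 0 = (1 - x \<bullet> y)\<^sup>2"
    by (simp add: q_def)
  have "(q has_real_derivative D) (at 0)"
    unfolding q_def[abs_def] by (auto intro!: derivative_eq_intros)
  then have "((\<lambda>e. sqrt (q e)) has_real_derivative inverse (sqrt (q 0)) / 2 * D) (at 0)"
    using xy by (intro DERIV_chain2[of sqrt] DERIV_real_sqrt) (auto simp: q0)
  moreover have "inverse (sqrt (q 0)) / 2 * D = D / (2 * (1 - x \<bullet> y))"
    using xy by (simp add: q0 divide_simps)
  ultimately have "((\<lambda>e. sqrt (q e)) has_real_derivative D / (2 * (1 - x \<bullet> y))) (at 0)"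
    by (rule DERIV_cong)
  moreover have "((\<lambda>e. x \<bullet> (y - x) + e * (x \<bullet> w)) has_real_derivative x \<bullet> w) (at 0)"
    by (auto intro!: derivative_eq_intros)
  ultimately have "((\<lambda>e. (sqrt (q e) + (x \<bullet> (y - x) + e * (x \<bullet> w))) / (1 - x \<bullet> x))
      has_real_derivative (D / (2 * (1 - x \<bullet> y)) + x \<bullet> w) / (1 - x \<bullet> x)) (at 0)"
    by (intro DERIV_cdivide DERIV_add)
  \<comment> \<open>Over the denominator \<open>1 - x \<bullet> y\<close> the multiples of
    \<open>x \<bullet> w\<close> cancel, and \<open>1 - x \<bullet> x\<close> drops out as a common
    factor.\<close>
  also have "(D / (2 * (1 - x \<bullet> y)) + x \<bullet> w) / (1 - x \<bullet> x) = (w \<bullet> y) / (1 - x \<bullet> y)"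
    using A xy by (simp add: D_def inner_diff inner_commute[of w] divide_simps) (simp add: algebra_simps)
  finally show "((\<lambda>e. funk_metric x (y - x + e *\<^sub>R w))
      has_real_derivative (w \<bullet> y) / (1 - x \<bullet> y)) (at 0)"
    unfolding funk_metric_def power2_norm_eq_inner rad_eq q_def
    by (simp add: inner_add_right add_divide_distrib)
qed

section \<open>The Busemann function\<close>

lemma tendsto_busemann:
  assumes "norm x < 1" "norm p < 1" "norm y = 1"
  shows "((\<lambda>t. t - funk_dist x (funk_geodesic p y t)) \<longlongrightarrow>
           ln ((1 - p \<bullet> y) / (1 - x \<bullet> y))) at_top"
proof -
  define g where "g e = funk_metric x (y - x + e *\<^sub>R (p - y))" for e
  have lt1: "z \<bullet> y < 1" if "norm z < 1" for z
    using norm_cauchy_schwarz[of z y] assms(3) that by simp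
  have D: "((p - y) \<bullet> y) / (1 - x \<bullet> y) = - ((1 - p \<bullet> y) / (1 - x \<bullet> y))"
    unfolding minus_divide_left using assms(3) by (simp add: inner_diff dot_square_norm)
  have "((\<lambda>e. (g e - g 0) / e) \<longlongrightarrow> - ((1 - p \<bullet> y) / (1 - x \<bullet> y))) (at 0)"
    using funk_metric_boundary(2)[OF assms(1,3), of "p - y"]
    unfolding D by (simp add: g_def[abs_def] has_field_derivative_iff)
  moreover have g0: "g 0 = 1"
    using funk_metric_boundary(1)[OF assms(1,3)] by (simp add: g_def)
  ultimately have "((\<lambda>e. - ((g e - 1) / e)) \<longlongrightarrow> (1 - p \<bullet> y) / (1 - x \<bullet> y)) (at 0)"
    using tendsto_minus by fastforce
  \<comment> \<open>The difference quotient converges along the punctured filter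
    \<open>at 0\<close>; \<open>exp (- t)\<close> qualifies since it tends to 0 without attaining
    it.\<close>
  moreover have "filterlim (\<lambda>t::real. exp (- t)) (at 0) at_top"
    unfolding filterlim_at
    by (auto intro: filterlim_compose[OF exp_at_bot filterlim_uminus_at_bot_at_top])
  ultimately have "((\<lambda>t. - ((g (exp (- t)) - 1) / exp (- t))) \<longlongrightarrow> (1 - p \<bullet> y) / (1 - x \<bullet> y)) at_top"
    by (rule filterlim_compose)
  then have lim: "((\<lambda>t. ln (- ((g (exp (- t)) - 1) / exp (- t)))) \<longlongrightarrow>
      ln ((1 - p \<bullet> y) / (1 - x \<bullet> y))) at_top"
    using lt1 assms by (intro tendsto_ln) (auto simp: less_le)
  \<comment> \<open>The restriction to \<open>t \<ge> 0\<close> keeps the geodesic in the disc,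
    where the distance formula applies; the limit only needs large \<open>t\<close>.\<close>
  have "ln (- ((g (exp (- t)) - 1) / exp (- t))) = t - funk_dist x (funk_geodesic p y t)"
    if "t \<ge> 0" for t
  proof -
    have n: "norm (funk_geodesic p y t) < 1"
      using funk_metric_geodesic(1)[of p y t] assms that by (simp add: frontier_ball)
    have v: "funk_geodesic p y t - x = y - x + exp (- t) *\<^sub>R (p - y)"
      by (simp add: funk_geodesic_def algebra_simps)
    have "g (exp (- t)) < 1"
      using funk_metric_less_1[OF assms(1) n] by (simp add: g_def v)
    moreover have "- ((g (exp (- t)) - 1) / exp (- t)) = (1 - g (exp (- t))) * exp t"
      by (simp add: exp_minus field_simps)
    ultimately show ?thesis
      using funk_dist_eq[OF assms(1) n] by (simp add: ln_mult v flip: g_def)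
  qed
  then show ?thesis
    by (intro Lim_transform_eventually[OF lim] eventually_mono[OF eventually_ge_at_top[of 0]])
qed

lemma forward_busemann_eq:
  assumes "norm x < 1" "norm p < 1" "norm y = 1"
  shows "forward_busemann (funk_geodesic p y) x = ln ((1 - p \<bullet> y) / (1 - x \<bullet> y))"
  unfolding forward_busemann_def by (intro tendsto_Lim tendsto_busemann assms) simp

section \<open>Chords of the disc\<close>

text \<open>In an orthonormal basis \<open>y\<close>, \<open>j\<close>, the points with
  \<open>y\<close>-coordinate \<open>c\<close> lie in the disc exactly when their
  \<open>j\<close>-coordinate is strictly between \<open>- s\<close> and \<open>s\<close>, by
  Pythagoras.\<close>

lemma disc_chord:
  fixes y :: "real^2"
  assumes "norm y = 1" "\<bar>c\<bar> < 1"
  obtains u v where "norm u = 1" "norm v = 1" "u \<noteq> v"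
    "{x \<in> disc. x \<bullet> y = c} = open_segment u v" "orthogonal (v - u) y"
proof -
  \<comment> \<open>\<open>j\<close> is \<open>y\<close> turned by a right angle, and
    \<open>s\<close> is half the length of the chord.\<close>
  define j :: "real^2" where "j = vector [- (y$2), y$1]"
  define s where "s = sqrt (1 - c\<^sup>2)"
  have c: "c\<^sup>2 < 1"
    using assms by (simp add: abs_square_less_1)
  have s: "s > 0" "s\<^sup>2 = 1 - c\<^sup>2"
    using c by (auto simp: s_def)
  have y: "y$1 * y$1 + y$2 * y$2 = 1"
    using assms(1) by (simp add: norm_eq_1 inner_vec_def sum_2)
  have yy: "y \<bullet> y = 1" and jj: "j \<bullet> j = 1" and yj: "y \<bullet> j = 0" "j \<bullet> y = 0"
    using y by (auto simp: j_def inner_vec_def sum_2)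
  have expand: "x = (x \<bullet> y) *\<^sub>R y + (x \<bullet> j) *\<^sub>R j" for x
  proof -
    have "x$1 * (y$1 * y$1 + y$2 * y$2) = x$1" "x$2 * (y$1 * y$1 + y$2 * y$2) = x$2"
      by (simp_all add: y)
    then show ?thesis
      by (simp add: vec_eq_iff forall_2 j_def inner_vec_def sum_2 algebra_simps)
  qed
  have nrm: "(norm (a *\<^sub>R y + b *\<^sub>R j))\<^sup>2 = a\<^sup>2 + b\<^sup>2" for a b
    unfolding power2_norm_eq_inner by (simp add: inner_add yy jj yj power2_eq_square)
  define u where "u = c *\<^sub>R y + (- s) *\<^sub>R j"
  define v where "v = c *\<^sub>R y + s *\<^sub>R j"
  have "(norm u)\<^sup>2 = 1" "(norm v)\<^sup>2 = 1"
    using s unfolding u_def v_def nrm by auto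
  then have 1: "norm u = 1" "norm v = 1"
    using power2_eq_1_iff norm_ge_zero by (smt (verit))+
  have vu: "v - u = (2 * s) *\<^sub>R j"
    by (simp add: u_def v_def flip: scaleR_add_left)
  have uv: "u \<noteq> v"
    using vu s jj by auto
  have pt: "(1 - k) *\<^sub>R u + k *\<^sub>R v = c *\<^sub>R y + ((2 * k - 1) * s) *\<^sub>R j" for k
    by (simp add: u_def v_def algebra_simps flip: scaleR_add_left)
  have "x \<in> {x \<in> disc. x \<bullet> y = c} \<longleftrightarrow> x \<in> open_segment u v" for x
  proof
    assume x: "x \<in> {x \<in> disc. x \<bullet> y = c}"
    then have e: "x = c *\<^sub>R y + (x \<bullet> j) *\<^sub>R j"
      using expand[of x] by simp
    have "(norm x)\<^sup>2 < 1"
      using x by (simp add: abs_square_less_1)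
    then have "(x \<bullet> j)\<^sup>2 < s\<^sup>2"
      using nrm[of c "x \<bullet> j"] s by (simp flip: e)
    then have b: "\<bar>x \<bullet> j\<bar> < s"
      using s by (metis abs_of_pos power2_less_imp_less power2_abs less_imp_le)
    \<comment> \<open>Solves \<open>(2 * k - 1) * s = x \<bullet> j\<close>, matching the
      parametrisation \<open>pt\<close>.\<close>
    define k where "k = (1 + (x \<bullet> j) / s) / 2"
    have "2 * k - 1 = (x \<bullet> j) / s"
      by (simp add: k_def add_divide_distrib)
    then have "(2 * k - 1) * s = x \<bullet> j"
      using s by simp
    then have "x = (1 - k) *\<^sub>R u + k *\<^sub>R v"
      unfolding pt using e by simp
    moreover have "0 < k" "k < 1"
      using b s by (auto simp: k_def field_simps abs_less_iff)
    ultimately show "x \<in> open_segment u v"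
      using uv by (auto simp: in_segment)
  next
    assume "x \<in> open_segment u v"
    then obtain k where k: "0 < k" "k < 1" "x = c *\<^sub>R y + ((2 * k - 1) * s) *\<^sub>R j"
      by (auto simp: in_segment pt)
    have "(2 * k - 1)\<^sup>2 < 1"
      using k by (simp add: abs_square_less_1 abs_less_iff)
    then have "((2 * k - 1) * s)\<^sup>2 < s\<^sup>2"
      using s(1) by (simp add: power_mult_distrib)
    then have "(norm x)\<^sup>2 < 1"
      using nrm s k by simp
    then have "norm x < 1"
      by (simp add: abs_square_less_1)
    moreover have "x \<bullet> y = c"
      by (simp add: k inner_add yy yj)
    ultimately show "x \<in> {x \<in> disc. x \<bullet> y = c}"
      by simp
  qed
  moreover have "orthogonal (v - u) y"
    by (simp add: vu orthogonal_def yj)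
  ultimately show thesis
    using that 1 uv by blast
qed

theorem proposition6p1:
  fixes p y :: "real^2"
  assumes "p \<in> disc" and "y \<in> frontier disc"
  shows "(\<forall>x\<in>disc. \<exists>l. ((\<lambda>t. t - funk_dist x (funk_geodesic p y t)) \<longlongrightarrow> l) at_top) \<and>
         (\<forall>H \<in> forward_horocycles (funk_geodesic p y).
            \<exists>u v. u \<in> frontier disc \<and> v \<in> frontier disc \<and> u \<noteq> v \<and>
                  H = open_segment u v \<and> orthogonal (v - u) (y - 0))"
proof (intro conjI ballI)
  have p: "norm p < 1" and y: "norm y = 1"
    using assms by (auto simp: frontier_ball)
  show "\<exists>l. ((\<lambda>t. t - funk_dist x (funk_geodesic p y t)) \<longlongrightarrow> l) at_top" if "x \<in> disc" for x
    using tendsto_busemann[of x p y] p y that by auto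
  have lt1: "\<bar>z \<bullet> y\<bar> < 1" if "norm z < 1" for z
    using Cauchy_Schwarz_ineq2[of z y] y that by simp
  fix H assume "H \<in> forward_horocycles (funk_geodesic p y)"
  \<comment> \<open>Nonemptiness supplies \<open>x0\<close>, so the level \<open>a\<close> can be
    replaced by the height \<open>x0 \<bullet> y\<close>, which is already known to lie strictly
    between -1 and 1.\<close>
  then obtain a x0 where H: "H = {x \<in> disc. forward_busemann (funk_geodesic p y) x = a}"
    and x0: "x0 \<in> H"
    by (auto simp: forward_horocycles_def)
  have n0: "norm x0 < 1" and a: "a = forward_busemann (funk_geodesic p y) x0"
    using x0 H by auto
  \<comment> \<open>Both values are logarithms of positive quotients with the same numerator
    \<open>1 - p \<bullet> y\<close>, so equality passes to the denominators.\<close>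
  have "forward_busemann (funk_geodesic p y) x = a \<longleftrightarrow> x \<bullet> y = x0 \<bullet> y" if "norm x < 1" for x
  proof -
    have "1 - p \<bullet> y > 0" "1 - x \<bullet> y > 0" "1 - x0 \<bullet> y > 0"
      using lt1 p that n0 by (smt (verit))+
    then show ?thesis
      unfolding a forward_busemann_eq[OF that p y] forward_busemann_eq[OF n0 p y]
      by (subst ln_inj_iff) (auto simp: field_simps)
  qed
  then have "H = {x \<in> disc. x \<bullet> y = x0 \<bullet> y}"
    unfolding H by auto
  then show "\<exists>u v. u \<in> frontier disc \<and> v \<in> frontier disc \<and> u \<noteq> v \<and>
                  H = open_segment u v \<and> orthogonal (v - u) (y - 0)"
    using disc_chord[OF y lt1[OF n0]] by (auto simp: frontier_ball) metis
qed

end
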